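(* Let $r>0$ and $n=1$. If $E\subseteq\mathbb{R}$ is a Class A minimizer for $\mathrm{Per}_r$, then $E$ is either $\varnothing$ or $\mathbb{R}$ or a halfline of the type either $(a,+\infty)$ or $(-\infty,a)$, for some $a\in\mathbb{R}$.
   Context: $B_\rho(x)$ is the ball of radius $\rho$ centered at $x$ in $\mathbb{R}^n$ (an interval when $n=1$), and $\mathcal{L}^n$ is the $n$-dimensional Lebesgue measure. For $A\subseteq\mathbb{R}^n$, $A\oplus B_r:=\bigcup_{x\in A}B_r(x)$ and $A\ominus B_r:=A\setminus\big((\partial A)\oplus B_r\big)$. Measurable sets are identified with their sets of points of density one (so equalities of sets are up to null sets), and $\partial E$ denotes the topological boundary of the set of points of density one of $E$. For a domain $\Omega$ and measurable $E\subseteq\mathbb{R}^n$, $$\mathrm{Per}_r(E,\Omega):=\frac{1}{2r}\mathcal{L}^n\Big(\big((\partial E)\oplus B_r\big)\cap\Omega\Big).$$ A set $E$ is a minimizer for $\mathrm{Per}_r$ in a bounded domain $\Omega$ if $\mathrm{Per}_r(E,\Omega)\le\mathrm{Per}_r(F,\Omega)$ for any measurable $F\subseteq\mathbb{R}^n$ with $F\setminus(\Omega\ominus B_r)=E\setminus(\Omega\ominus B_r)$. $E$ is a Class A minimizer if it is a minimizer in this sense in any ball of $\mathbb{R}^n$. *)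

theory Defs
  imports "HOL-Analysis.Analysis"
begin

definition density_one_points :: "'a::euclidean_space set \<Rightarrow> 'a set" where
  "density_one_points E =
     {x. ((\<lambda>\<rho>. measure lebesgue (E \<inter> ball x \<rho>) / measure lebesgue (ball x \<rho>)) \<longlongrightarrow> 1) (at_right 0)}"

definition ae_equal :: "'a::euclidean_space set \<Rightarrow> 'a set \<Rightarrow> bool" where
  "ae_equal E F \<longleftrightarrow> (E - F) \<union> (F - E) \<in> null_sets lebesgue"

(* The boundary of a measurable set taken modulo null sets; it does not depend on the
   representative E, unlike frontier E. *)
definition density_boundary :: "'a::euclidean_space set \<Rightarrow> 'a set" where
  "density_boundary E = frontier (density_one_points E)"

definition enlarge :: "'a::euclidean_space set \<Rightarrow> real \<Rightarrow> 'a set" where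
  "enlarge A r = (\<Union>x\<in>A. ball x r)"

(* Applied only to domains, so the boundary is the ordinary topological one. For balls it
   coincides with density_boundary. *)
definition shrink :: "'a::euclidean_space set \<Rightarrow> real \<Rightarrow> 'a set" where
  "shrink A r = A - enlarge (frontier A) r"

(* Extended-valued, since the domain may have infinite measure. *)
definition Per :: "real \<Rightarrow> 'a::euclidean_space set \<Rightarrow> 'a set \<Rightarrow> ennreal" where
  "Per r E \<Omega> = ennreal (1 / (2 * r)) * emeasure lebesgue (enlarge (density_boundary E) r \<inter> \<Omega>)"

definition Per_minimizer :: "real \<Rightarrow> 'a::euclidean_space set \<Rightarrow> 'a set \<Rightarrow> bool" where
  "Per_minimizer r E \<Omega> \<longleftrightarrow>
     E \<in> sets lebesgue \<and>
     (\<forall>F \<in> sets lebesgue.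
        ae_equal (F - shrink \<Omega> r) (E - shrink \<Omega> r) \<longrightarrow> Per r E \<Omega> \<le> Per r F \<Omega>)"

definition class_A_minimizer :: "real \<Rightarrow> 'a::euclidean_space set \<Rightarrow> bool" where
  "class_A_minimizer r E \<longleftrightarrow> (\<forall>x \<rho>. \<rho> > 0 \<longrightarrow> Per_minimizer r E (ball x \<rho>))"

end

theory Submission
  imports Defs
begin

text \<open>
Two competitors suffice. Write \<open>B\<close> for the boundary of the set \<open>D\<close> of density points of \<open>E\<close>,
and \<open>N\<close> for its open \<open>r\<close>-neighbourhood.

First, delete from \<open>E\<close> everything in \<open>{r - R..R - r}\<close>, the part of the ball of radius \<open>R\<close>
that may be altered. The boundary of the competitor stays at distance at least \<open>R - r\<close> from the
origin, so its neighbourhood meets the ball in measure at most \<open>4r\<close>. By minimality \<open>N\<close> has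
measure at most \<open>4r\<close> in every ball. Three points of \<open>B\<close> that are \<open>2r\<close> apart would contribute
\<open>6r\<close>, so \<open>B\<close> is bounded (\<open>bounded_density_boundary\<close>).

Secondly, beyond a bounded interval that contains \<open>B\<close>, connectedness and the Lebesgue density
theorem show that \<open>E\<close> is, up to null sets, empty or full on the left, and likewise on the right.
Hence \<open>E\<close> agrees near infinity with the empty set, the line, or a halfline starting at \<open>0\<close>
(\<open>flat_outside_density_boundary\<close>). That set has at most one boundary point, so as a competitor
it shows that \<open>N\<close> has measure at most \<open>2r\<close>. Two distinct points of \<open>B\<close> already give strictly
more, so \<open>B\<close> is contained in a singleton \<open>{c}\<close> (\<open>density_boundary_at_most_one_point\<close>). The same
description of \<open>E\<close> off an interval containing \<open>B\<close>, now for the interval \<open>{c..c}\<close>, is the claim.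
\<close>

section \<open>The Lebesgue density theorem on the line\<close>

lemma integral_indicator_Icc:
  fixes E :: "real set"
  assumes "E \<in> sets lebesgue"
  shows "indicat_real E integrable_on {a..b}"
    and "integral {a..b} (indicat_real E) = measure lebesgue (E \<inter> {a..b})"
proof -
  have "E \<inter> {a..b} \<in> lmeasurable"
    using assms by (metis inf_commute lmeasurable_interval(1) cbox_interval lmeasurable_cbox fmeasurable_Int_fmeasurable)
  then show "indicat_real E integrable_on {a..b}"
    and "integral {a..b} (indicat_real E) = measure lebesgue (E \<inter> {a..b})"
    by (simp_all add: integrable_on_indicator integral_indicator)
qed

text \<open>
One-sided densities of \<open>E\<close> are difference quotients of an indefinite integral of its indicator,
which converge to the indicator almost everywhere.
\<close>

lemma negligible_nonright_density_points:
  fixes E :: "real set"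
  assumes "E \<in> sets lebesgue"
  obtains N where "negligible N"
    "\<And>x e. \<lbrakk>x \<in> E - N; 0 < e\<rbrakk> \<Longrightarrow>
       \<exists>d>0. \<forall>h. 0 < h \<and> h < d \<longrightarrow> \<bar>measure lebesgue (E \<inter> {x..x + h}) / h - 1\<bar> < e"
proof -
  have "indicat_real E integrable_on cbox a b" for a b
    using integral_indicator_Icc(1)[OF assms] by simp
  then obtain N where "negligible N" and N: "\<And>x e. \<lbrakk>x \<notin> N; 0 < e\<rbrakk> \<Longrightarrow>
      \<exists>d>0. \<forall>h. 0 < h \<and> h < d \<longrightarrow>
        norm (integral (cbox x (x + h *\<^sub>R One)) (indicat_real E) /\<^sub>R h ^ DIM(real) - indicat_real E x) < e"
    using integrable_ccontinuous_explicit by blast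
  show thesis
  proof
    show "negligible N" by fact
    fix x e :: real assume "x \<in> E - N" "0 < e"
    with N[of x e] show "\<exists>d>0. \<forall>h. 0 < h \<and> h < d \<longrightarrow> \<bar>measure lebesgue (E \<inter> {x..x + h}) / h - 1\<bar> < e"
      by (simp add: integral_indicator_Icc(2)[OF assms] divide_inverse mult.commute)
  qed
qed

lemma lebesgue_reflect_Icc:
  fixes E :: "real set"
  shows "measure lebesgue (uminus ` E \<inter> {-x..-x + h}) = measure lebesgue (E \<inter> {x - h..x})"
proof -
  have "uminus ` E \<inter> {-x..-x + h} = (\<lambda>y. (-1) *\<^sub>R y) ` (E \<inter> {x - h..x})"
    by (auto simp: image_iff)
  then show ?thesis
    using measure_lebesgue_affine[of "-1" 0 "E \<inter> {x - h..x}"] by simp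
qed

lemma ball_content_real:
  assumes "0 \<le> h"
  shows "measure lebesgue (ball (x::real) h) = 2 * h"
  using assms by (simp add: ball_eq_greaterThanLessThan)

text \<open>
The two-sided density quotient is the average of the quotients on the left and on the right. The
left one is a right one for the set reflected in the origin, whose exceptional null set \<open>L\<close> must
therefore be reflected back.
\<close>

lemma negligible_diff_density_one_points:
  fixes E :: "real set"
  assumes "E \<in> sets lebesgue"
  shows "negligible (E - density_one_points E)"
proof -
  have "uminus ` E \<in> sets lebesgue"
  proof -
    have "uminus ` E = (*\<^sub>R) (-1) -` E \<inter> space lebesgue"
      by (force simp: image_iff)
    then show ?thesis
      using measurable_sets[OF lebesgue_measurable_scaling assms] by simp
  qed
  then obtain L where L: "negligible L" "\<And>x e. \<lbrakk>x \<in> uminus ` E - L; 0 < e\<rbrakk> \<Longrightarrow>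
      \<exists>d>0. \<forall>h. 0 < h \<and> h < d \<longrightarrow> \<bar>measure lebesgue (uminus ` E \<inter> {x..x + h}) / h - 1\<bar> < e"
    using negligible_nonright_density_points by blast
  obtain N where N: "negligible N" "\<And>x e. \<lbrakk>x \<in> E - N; 0 < e\<rbrakk> \<Longrightarrow>
      \<exists>d>0. \<forall>h. 0 < h \<and> h < d \<longrightarrow> \<bar>measure lebesgue (E \<inter> {x..x + h}) / h - 1\<bar> < e"
    using negligible_nonright_density_points[OF assms] by blast
  have "x \<in> density_one_points E" if x: "x \<in> E" "x \<notin> N" "x \<notin> uminus ` L" for x
    unfolding density_one_points_def mem_Collect_eq
  proof (rule tendstoI)
    fix e :: real assume "0 < e"
    obtain d1 where d1: "d1 > 0" "\<And>h. 0 < h \<and> h < d1 \<Longrightarrow> \<bar>measure lebesgue (E \<inter> {x..x + h}) / h - 1\<bar> < e"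
      using N(2)[of x e] x \<open>0 < e\<close> by auto
    have "- x \<in> uminus ` E - L" using x by (auto simp: image_iff)
    then obtain d2 where d2: "d2 > 0" "\<And>h. 0 < h \<and> h < d2 \<Longrightarrow> \<bar>measure lebesgue (E \<inter> {x - h..x}) / h - 1\<bar> < e"
      using L(2)[of "-x" e] \<open>0 < e\<close> lebesgue_reflect_Icc[of E x] by auto
    have "dist (measure lebesgue (E \<inter> ball x h) / measure lebesgue (ball x h)) 1 < e"
      if h: "0 < h" "h < min d1 d2" for h
    proof -
      let ?l = "measure lebesgue (E \<inter> {x - h..x})" and ?r = "measure lebesgue (E \<inter> {x..x + h})"
      have lm: "E \<inter> {a..b} \<in> lmeasurable" for a b
        using assms by (metis inf_commute cbox_interval lmeasurable_cbox fmeasurable_Int_fmeasurable)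
      have "measure lebesgue (E \<inter> ball x h) = measure lebesgue (E \<inter> {x - h..x} \<union> E \<inter> {x..x + h})"
        by (rule measure_negligible_symdiff[OF fmeasurable.Un[OF lm lm]])
           (rule negligible_subset[of "{x - h, x + h}"], auto simp: ball_eq_greaterThanLessThan)
      also have "\<dots> = ?l + ?r"
      proof -
        have "negligible ((E \<inter> {x - h..x}) \<inter> (E \<inter> {x..x + h}))"
          by (rule negligible_subset[of "{x}"]) auto
        then show ?thesis
          by (simp add: measure_Un3[OF lm lm] negligible_imp_measure0)
      qed
      finally have "measure lebesgue (E \<inter> ball x h) = ?l + ?r" .
      then have "measure lebesgue (E \<inter> ball x h) / measure lebesgue (ball x h) - 1
          = ((?l / h - 1) + (?r / h - 1)) / 2"
        using h unfolding ball_content_real[OF less_imp_le[OF h(1)]] by (simp add: field_simps)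
      moreover have "\<bar>?l / h - 1\<bar> < e" "\<bar>?r / h - 1\<bar> < e"
        using d1(2)[of h] d2(2)[of h] h by auto
      moreover have "\<bar>u\<bar> < e" if "u = (v + w) / 2" "\<bar>v\<bar> < e" "\<bar>w\<bar> < e" for u v w :: real
        using that unfolding abs_less_iff by (simp add: field_simps)
      ultimately show ?thesis
        unfolding dist_real_def by blast
    qed
    then show "\<forall>\<^sub>F h in at_right 0. dist (measure lebesgue (E \<inter> ball x h) / measure lebesgue (ball x h)) 1 < e"
      using d1 d2 by (intro eventually_at_rightI[of 0 "min d1 d2"]) auto
  qed
  then have "E - density_one_points E \<subseteq> N \<union> uminus ` L" by blast
  moreover have "negligible (uminus ` L)"
    using L(1) by (rule negligible_differentiable_image_negligible[rotated])
      (auto intro: derivative_intros)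
  ultimately show ?thesis using N(1) by (meson negligible_Un negligible_subset)
qed

lemma Compl_sets_lebesgue: "E \<in> sets lebesgue \<Longrightarrow> - E \<in> sets lebesgue"
  using sets.compl_sets[of E lebesgue] by (simp add: Compl_eq_Diff_UNIV)

text \<open>
The density quotients of a set and its complement add up to \<open>1\<close>, so they cannot both tend to \<open>1\<close>.
This turns the statement that almost every point of \<open>E\<close> is a density point, applied to the
complement, into the converse inclusion.
\<close>

lemma density_one_points_Compl_disjoint:
  fixes E :: "'a::euclidean_space set"
  assumes "E \<in> sets lebesgue"
  shows "density_one_points E \<inter> density_one_points (- E) = {}"
proof (rule ccontr)
  assume "density_one_points E \<inter> density_one_points (- E) \<noteq> {}"
  then obtain x where
    "((\<lambda>\<rho>. measure lebesgue (E \<inter> ball x \<rho>) / measure lebesgue (ball x \<rho>)) \<longlongrightarrow> 1) (at_right 0)"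
    "((\<lambda>\<rho>. measure lebesgue (- E \<inter> ball x \<rho>) / measure lebesgue (ball x \<rho>)) \<longlongrightarrow> 1) (at_right 0)"
    unfolding density_one_points_def by auto
  from tendsto_add[OF this] 
  have *: "((\<lambda>\<rho>. (measure lebesgue (E \<inter> ball x \<rho>) + measure lebesgue (- E \<inter> ball x \<rho>)) / measure lebesgue (ball x \<rho>)) \<longlongrightarrow> 2) (at_right 0)"
    by (simp add: add_divide_distrib)
  have "measure lebesgue (E \<inter> ball x \<rho>) + measure lebesgue (- E \<inter> ball x \<rho>) = measure lebesgue (ball x \<rho>)" for \<rho>
  proof -
    have "(E \<inter> ball x \<rho>) \<union> (- E \<inter> ball x \<rho>) = ball x \<rho>"
      and "(E \<inter> ball x \<rho>) \<inter> (- E \<inter> ball x \<rho>) = {}" by auto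
    moreover have "E \<inter> ball x \<rho> \<in> lmeasurable" "- E \<inter> ball x \<rho> \<in> lmeasurable"
      using assms Compl_sets_lebesgue[OF assms]
      by (metis inf_commute lmeasurable_ball fmeasurable_Int_fmeasurable)+
    ultimately show ?thesis
      using measure_Un3[of "E \<inter> ball x \<rho>" lebesgue "- E \<inter> ball x \<rho>"] by simp
  qed
  then have "\<forall>\<^sub>F \<rho> in at_right 0. (measure lebesgue (E \<inter> ball x \<rho>) + measure lebesgue (- E \<inter> ball x \<rho>)) / measure lebesgue (ball x \<rho>) = 1"
    by (intro eventually_at_rightI[of 0 1]) (auto simp: content_ball_pos less_imp_neq[symmetric])
  then have "((\<lambda>\<rho>. (measure lebesgue (E \<inter> ball x \<rho>) + measure lebesgue (- E \<inter> ball x \<rho>)) / measure lebesgue (ball x \<rho>)) \<longlongrightarrow> 1) (at_right 0)"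
    by (rule tendsto_eventually)
  with * have "(2::real) = 1" by (rule tendsto_unique[rotated]) simp
  then show False by simp
qed

theorem Lebesgue_density_real:
  fixes E :: "real set"
  assumes "E \<in> sets lebesgue"
  shows "negligible (E - density_one_points E)" "negligible (density_one_points E - E)"
proof -
  show "negligible (E - density_one_points E)"
    by (rule negligible_diff_density_one_points[OF assms])
  from negligible_diff_density_one_points[OF Compl_sets_lebesgue[OF assms]]
  show "negligible (density_one_points E - E)"
    by (rule negligible_subset) (use density_one_points_Compl_disjoint[OF assms] in auto)
qed

section \<open>Sets with at most one boundary point\<close>

text \<open>
Density is a local notion: inside such a \<open>U\<close> either every point or no point is a density point.
This locates the boundaries of all competitors.
\<close>

lemma open_disjoint_density_boundary:
  fixes F :: "'a::euclidean_space set"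
  assumes "open U" and "U \<subseteq> F \<or> U \<inter> F = {}"
  shows "U \<inter> density_boundary F = {}"
proof -
  have small: "\<forall>\<^sub>F \<rho> in at_right 0. ball x \<rho> \<subseteq> U" if x: "x \<in> U" for x
  proof -
    obtain e where "0 < e" "ball x e \<subseteq> U" using assms(1) x openE by blast
    then show ?thesis by (intro eventually_at_rightI[of 0 e]) (auto intro: less_trans)
  qed
  show ?thesis using assms(2)
  proof
    assume UF: "U \<subseteq> F"
    have "U \<subseteq> density_one_points F"
    proof
      fix x assume "x \<in> U"
      have "\<forall>\<^sub>F \<rho> in at_right 0. measure lebesgue (F \<inter> ball x \<rho>) / measure lebesgue (ball x \<rho>) = 1"
        using small[OF \<open>x \<in> U\<close>] eventually_at_right_less[of 0]
      proof eventually_elim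
        case (elim \<rho>)
        then have "F \<inter> ball x \<rho> = ball x \<rho>" using UF by auto
        then show ?case using elim content_ball_pos[of \<rho> x] by simp
      qed
      then show "x \<in> density_one_points F"
        unfolding density_one_points_def by (auto intro: tendsto_eventually)
    qed
    then have "U \<subseteq> interior (density_one_points F)" using assms(1) by (rule interior_maximal)
    then show ?thesis unfolding density_boundary_def frontier_def by auto
  next
    assume UF: "U \<inter> F = {}"
    have "x \<notin> density_one_points F" if "x \<in> U" for x
    proof
      assume "x \<in> density_one_points F"
      then have lim: "((\<lambda>\<rho>. measure lebesgue (F \<inter> ball x \<rho>) / measure lebesgue (ball x \<rho>)) \<longlongrightarrow> 1) (at_right 0)"
        unfolding density_one_points_def by simp
      have "\<forall>\<^sub>F \<rho> in at_right 0. measure lebesgue (F \<inter> ball x \<rho>) / measure lebesgue (ball x \<rho>) = 0"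
        using small[OF that]
      proof eventually_elim
        case (elim \<rho>)
        then have "F \<inter> ball x \<rho> = {}" using UF by auto
        then show ?case by simp
      qed
      then have "((\<lambda>\<rho>. measure lebesgue (F \<inter> ball x \<rho>) / measure lebesgue (ball x \<rho>)) \<longlongrightarrow> 0) (at_right 0)"
        by (rule tendsto_eventually)
      with lim have "(1::real) = 0" by (rule tendsto_unique[rotated]) simp
      then show False by simp
    qed
    then have "U \<inter> density_one_points F = {}" by auto
    then have "U \<inter> closure (density_one_points F) = {}"
      using open_Int_closure_eq_empty[OF assms(1)] by blast
    then show ?thesis unfolding density_boundary_def frontier_def by auto
  qed
qed

lemma connected_disjoint_density_boundary:
  fixes E :: "real set"
  assumes "E \<in> sets lebesgue" and "connected U" and "U \<inter> density_boundary E = {}"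
  shows "negligible (U \<inter> E) \<or> negligible (U - E)"
proof -
  have "U \<inter> density_one_points E = {} \<or> U - density_one_points E = {}"
    using connected_Int_frontier[OF assms(2)] assms(3) unfolding density_boundary_def by blast
  then show ?thesis
  proof
    assume "U \<inter> density_one_points E = {}"
    then have "U \<inter> E \<subseteq> E - density_one_points E" by auto
    then show ?thesis using Lebesgue_density_real(1)[OF assms(1)] negligible_subset by blast
  next
    assume "U - density_one_points E = {}"
    then have "U - E \<subseteq> density_one_points E - E" by auto
    then show ?thesis using Lebesgue_density_real(2)[OF assms(1)] negligible_subset by blast
  qed
qed

text \<open>
The possible shapes of a minimizer. The same sets serve as competitors: those with \<open>c = 0\<close> are
glued to \<open>E\<close> near the ends of a large ball, far from their own boundary point.
\<close>

definition flat_sets :: "real \<Rightarrow> real set set" where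
  "flat_sets c = {{}, UNIV, {c<..}, {..<c}}"

lemma density_boundary_flat_sets:
  assumes "G \<in> flat_sets c"
  shows "density_boundary G \<subseteq> {c}"
proof -
  have "{c<..} \<inter> density_boundary G = {}" "{..<c} \<inter> density_boundary G = {}"
    using assms unfolding flat_sets_def by (intro open_disjoint_density_boundary; fastforce)+
  then show ?thesis by (force simp: disjoint_iff)
qed

lemma flat_sets_measurable: "G \<in> flat_sets c \<Longrightarrow> G \<in> sets lebesgue"
  unfolding flat_sets_def by auto

text \<open>
Each of the rays \<open>{..<a}\<close> and \<open>{b<..}\<close> is connected and misses the boundary, so \<open>E\<close> is
null or full on it; the four combinations match the four members of \<open>flat_sets c\<close>. With a large
interval this yields a competitor, with \<open>a = b = c\<close> it determines \<open>E\<close>.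
\<close>

lemma flat_outside_density_boundary:
  fixes E :: "real set"
  assumes "E \<in> sets lebesgue" and "density_boundary E \<subseteq> {a..b}" and "a \<le> c" "c \<le> b"
  obtains G where "G \<in> flat_sets c" and "negligible ((E - G) \<union> (G - E) - {a..b})"
proof -
  have "negligible ({..<a} \<inter> E) \<or> negligible ({..<a} - E)"
    using assms(2) by (intro connected_disjoint_density_boundary[OF assms(1)]) auto
  moreover have "negligible ({b<..} \<inter> E) \<or> negligible ({b<..} - E)"
    using assms(2) by (intro connected_disjoint_density_boundary[OF assms(1)]) auto
  ultimately consider
      "negligible ({..<a} \<inter> E \<union> {b<..} \<inter> E)"
    | "negligible ({..<a} \<inter> E \<union> ({b<..} - E))"
    | "negligible (({..<a} - E) \<union> {b<..} \<inter> E)"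
    | "negligible (({..<a} - E) \<union> ({b<..} - E))"
    by (meson negligible_Un)
  then show thesis
  proof cases
    case 1
    show thesis
      by (intro that[of "{}"] negligible_subset[OF 1]) (auto simp: flat_sets_def)
  next
    case 2
    show thesis
      using assms(3,4) by (intro that[of "{c<..}"] negligible_subset[OF 2]) (auto simp: flat_sets_def)
  next
    case 3
    show thesis
      using assms(3,4) by (intro that[of "{..<c}"] negligible_subset[OF 3]) (auto simp: flat_sets_def)
  next
    case 4
    show thesis
      by (intro that[of UNIV] negligible_subset[OF 4]) (auto simp: flat_sets_def)
  qed
qed

section \<open>Comparison with competitors\<close>

lemma shrink_ball_real:
  fixes R r :: real
  assumes "0 < r" "r < R"
  shows "shrink (ball (0::real) R) r = {r - R..R - r}"
proof -
  have "frontier (ball (0::real) R) = {-R, R}"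
    using assms by (auto simp: ball_eq_greaterThanLessThan frontier_def)
  then show ?thesis
    using assms unfolding shrink_def enlarge_def by (auto simp: ball_eq_greaterThanLessThan)
qed

lemma class_A_minimizer_compare:
  fixes E :: "real set"
  assumes "class_A_minimizer r E" and "0 < r" "r < R" and "F \<in> sets lebesgue"
    and "negligible ((E - F) \<union> (F - E) - {r - R..R - r})"
  shows "emeasure lebesgue (enlarge (density_boundary E) r \<inter> ball 0 R)
       \<le> emeasure lebesgue (enlarge (density_boundary F) r \<inter> ball 0 R)"
proof -
  have "(F - {r - R..R - r} - (E - {r - R..R - r})) \<union> (E - {r - R..R - r} - (F - {r - R..R - r}))
      = (E - F) \<union> (F - E) - {r - R..R - r}" by blast
  then have "ae_equal (F - shrink (ball 0 R) r) (E - shrink (ball 0 R) r)"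
    unfolding ae_equal_def shrink_ball_real[OF assms(2,3)] using assms(5) by (simp add: negligible_iff_null_sets)
  then have "Per r E (ball 0 R) \<le> Per r F (ball 0 R)"
    using assms unfolding class_A_minimizer_def Per_minimizer_def by auto
  then show ?thesis
    unfolding Per_def using assms(2) by (subst (asm) ennreal_mult_le_mult_iff) auto
qed

lemma enlarge_sets_lebesgue: "enlarge A r \<inter> ball x R \<in> sets lebesgue"
proof -
  have "open (enlarge A r \<inter> ball x R)"
    unfolding enlarge_def by auto
  then show ?thesis by (metis borel_open sets_completionI_sets sets_lborel)
qed

text \<open>
The competitor empties the part of the ball that may be altered. This moves its boundary out to
distance at least \<open>R - r\<close> from the origin, and the neighbourhood of that boundary meets the ball
only in two end intervals of length \<open>2r\<close>. The bound is independent of \<open>R\<close>.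
\<close>

lemma emeasure_enlarge_boundary_le:
  fixes E :: "real set"
  assumes "class_A_minimizer r E" and "0 < r" "2 * r \<le> R" and E: "E \<in> sets lebesgue"
  shows "emeasure lebesgue (enlarge (density_boundary E) r \<inter> ball 0 R) \<le> ennreal (4 * r)"
proof -
  let ?K = "{r - R..R - r}"
  have "{r - R<..<R - r} \<inter> density_boundary (E - ?K) = {}"
    by (rule open_disjoint_density_boundary) auto
  then have sub: "enlarge (density_boundary (E - ?K)) r \<inter> ball 0 R \<subseteq> {-R<..<2 * r - R} \<union> {R - 2 * r<..<R}"
    unfolding enlarge_def by (force simp: ball_eq_greaterThanLessThan disjoint_iff)
  have "emeasure lebesgue (enlarge (density_boundary E) r \<inter> ball 0 R)
      \<le> emeasure lebesgue (enlarge (density_boundary (E - ?K)) r \<inter> ball 0 R)"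
  proof (rule class_A_minimizer_compare[OF assms(1,2)])
    have "(E - (E - ?K)) \<union> (E - ?K - E) - ?K = {}" by auto
    then show "negligible ((E - (E - ?K)) \<union> (E - ?K - E) - ?K)" by simp
  qed (use assms in auto)
  also have "\<dots> \<le> emeasure lebesgue ({-R<..<2 * r - R} \<union> {R - 2 * r<..<R})"
    by (rule emeasure_mono[OF sub]) auto
  also have "\<dots> \<le> emeasure lebesgue {-R<..<2 * r - R} + emeasure lebesgue {R - 2 * r<..<R}"
    by (rule emeasure_subadditive) auto
  also have "\<dots> = ennreal (4 * r)"
    using assms by (simp flip: ennreal_plus)
  finally show ?thesis .
qed

text \<open>
An unbounded boundary contains three points whose \<open>r\<close>-balls are disjoint, hence of total measure
\<open>6r\<close>, against the uniform bound \<open>4r\<close>.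
\<close>

lemma bounded_density_boundary:
  fixes E :: "real set"
  assumes "class_A_minimizer r E" and "0 < r" and "E \<in> sets lebesgue"
  shows "bounded (density_boundary E)"
proof (rule ccontr)
  assume "\<not> bounded (density_boundary E)"
  then have far: "\<exists>x\<in>density_boundary E. M < \<bar>x\<bar>" for M
    unfolding bounded_iff by (metis not_le real_norm_def)
  obtain p where p: "p \<in> density_boundary E" using far by blast
  obtain q where q: "q \<in> density_boundary E" "\<bar>p\<bar> + 2 * r < \<bar>q\<bar>" using far by blast
  obtain s where s: "s \<in> density_boundary E" "\<bar>q\<bar> + 2 * r < \<bar>s\<bar>" using far by blast
  let ?R = "\<bar>s\<bar> + 2 * r"
  have "ennreal (6 * r) = emeasure lebesgue (ball p r) + emeasure lebesgue (ball q r) + emeasure lebesgue (ball s r)"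
    using assms by (simp add: ball_eq_greaterThanLessThan flip: ennreal_plus)
  also have "\<dots> = emeasure lebesgue (ball p r \<union> ball q r) + emeasure lebesgue (ball s r)"
    using q by (subst plus_emeasure) (auto simp: ball_eq_greaterThanLessThan)
  also have "\<dots> = emeasure lebesgue (ball p r \<union> ball q r \<union> ball s r)"
    using q s assms(2) by (subst plus_emeasure) (auto simp: ball_eq_greaterThanLessThan)
  also have "\<dots> \<le> emeasure lebesgue (enlarge (density_boundary E) r \<inter> ball 0 ?R)"
  proof (rule emeasure_mono)
    show "ball p r \<union> ball q r \<union> ball s r \<subseteq> enlarge (density_boundary E) r \<inter> ball 0 ?R"
      using p q s unfolding enlarge_def by (auto simp: dist_real_def)
  qed (rule enlarge_sets_lebesgue)
  also have "\<dots> \<le> ennreal (4 * r)"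
    using assms by (intro emeasure_enlarge_boundary_le) auto
  finally show False using assms(2) by simp
qed

text \<open>
Since the boundary is bounded, a set with at most one boundary point is an admissible competitor in
a large ball, and the neighbourhood of a point has measure \<open>2r\<close>. The neighbourhood of two distinct
points is strictly larger.
\<close>

lemma density_boundary_at_most_one_point:
  fixes E :: "real set"
  assumes "class_A_minimizer r E" and "0 < r" and E: "E \<in> sets lebesgue"
  obtains c where "density_boundary E \<subseteq> {c}"
proof -
  obtain M where "M > 0" and "\<forall>x\<in>density_boundary E. \<bar>x\<bar> \<le> M"
    using bounded_density_boundary[OF assms] unfolding bounded_pos by auto
  then have M: "M > 0" "density_boundary E \<subseteq> {-M..M}" by (force simp: abs_le_iff)+
  obtain G where G: "G \<in> flat_sets 0" "negligible ((E - G) \<union> (G - E) - {-M..M})"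
    using flat_outside_density_boundary[OF E M(2), of 0] M(1) by auto
  \<comment> \<open>Large enough that the alterable part \<open>{r - ?R..?R - r}\<close> contains \<open>{-M..M}\<close>, where \<open>E\<close> and \<open>G\<close>
    may differ, and that the ball contains the \<open>r\<close>-neighbourhood of the boundary.\<close>
  let ?R = "M + 2 * r"
  have "emeasure lebesgue (enlarge (density_boundary E) r \<inter> ball 0 ?R)
      \<le> emeasure lebesgue (enlarge (density_boundary G) r \<inter> ball 0 ?R)"
  proof (rule class_A_minimizer_compare[OF assms(1,2)])
    show "negligible ((E - G) \<union> (G - E) - {r - ?R..?R - r})"
      by (rule negligible_subset[OF G(2)]) (use assms(2) in auto)
  qed (use M(1) assms(2) flat_sets_measurable[OF G(1)] in auto)
  also have "\<dots> \<le> emeasure lebesgue (ball (0::real) r)"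
    using density_boundary_flat_sets[OF G(1)] unfolding enlarge_def by (intro emeasure_mono) auto
  also have "\<dots> = ennreal (2 * r)"
    using assms(2) by (simp add: ball_eq_greaterThanLessThan)
  finally have le: "emeasure lebesgue (enlarge (density_boundary E) r \<inter> ball 0 ?R) \<le> ennreal (2 * r)" .
  have False if pq: "p \<in> density_boundary E" "q \<in> density_boundary E" "p < q" for p q
  proof -
    \<comment> \<open>The last \<open>t\<close> of the interval around \<open>q\<close> lies beyond the interval around \<open>p\<close>.\<close>
    define t where "t = min (q - p) (2 * r)"
    have t: "0 < t" "t \<le> q - p" "t \<le> 2 * r" using pq assms(2) by (auto simp: t_def)
    have pqM: "\<bar>p\<bar> \<le> M" "\<bar>q\<bar> \<le> M" using M(2) pq by (force simp: abs_le_iff)+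
    have "ennreal (2 * r + t) = emeasure lebesgue {p - r<..<p + r} + emeasure lebesgue {q + r - t<..<q + r}"
      using assms(2) t by (simp flip: ennreal_plus)
    also have "\<dots> = emeasure lebesgue ({p - r<..<p + r} \<union> {q + r - t<..<q + r})"
      using t by (subst plus_emeasure) auto
    also have "\<dots> \<le> emeasure lebesgue (enlarge (density_boundary E) r \<inter> ball 0 ?R)"
    proof (rule emeasure_mono)
      have "{p - r<..<p + r} \<subseteq> ball p r" "{q + r - t<..<q + r} \<subseteq> ball q r"
        using t by (auto simp: ball_eq_greaterThanLessThan)
      moreover have "{p - r<..<p + r} \<union> {q + r - t<..<q + r} \<subseteq> ball 0 ?R"
        using t pqM assms(2) by (auto simp: ball_eq_greaterThanLessThan)
      ultimately show "{p - r<..<p + r} \<union> {q + r - t<..<q + r} \<subseteq> enlarge (density_boundary E) r \<inter> ball 0 ?R"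
        using pq unfolding enlarge_def by blast
    qed (rule enlarge_sets_lebesgue)
    also note le
    finally show False using t(1) assms(2) by simp
  qed
  then have "x = y" if "x \<in> density_boundary E" "y \<in> density_boundary E" for x y
    using that by (meson linorder_neqE)
  then show thesis
    using that by (metis insertI1 subsetI empty_iff)
qed

theorem theorem1p11:
  fixes r :: real and E :: "real set"
  assumes "r > 0"
    and "class_A_minimizer r E"
  shows "ae_equal E {} \<or> ae_equal E UNIV \<or>
         (\<exists>a. ae_equal E {a<..} \<or> ae_equal E {..<a})"
proof -
  have E: "E \<in> sets lebesgue"
    using assms(2) zero_less_one unfolding class_A_minimizer_def Per_minimizer_def by blast
  obtain c where "density_boundary E \<subseteq> {c}"
    using density_boundary_at_most_one_point[OF assms(2,1) E] .
  then obtain G where G: "G \<in> flat_sets c" "negligible ((E - G) \<union> (G - E) - {c..c})"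
    using flat_outside_density_boundary[OF E, of c c c] by auto
  have "negligible ((E - G) \<union> (G - E) - {c..c} \<union> {c})"
    using G(2) by (intro negligible_Un) auto
  then have "negligible ((E - G) \<union> (G - E))"
    by (rule negligible_subset) auto
  then have "ae_equal E G"
    unfolding ae_equal_def by (simp add: negligible_iff_null_sets)
  with G(1) show ?thesis
    unfolding flat_sets_def by blast
qed

end
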